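(* Let $k\ge 1$ and $p\ge 0$ be integers. Let the chiral-type system $\Delta^\alpha\equiv U^\alpha_{xy}+G^\alpha_{\beta\gamma}U^\beta_xU^\gamma_y+Q^\alpha=0$ ($\alpha=1,\dots,n$) admit a matrix $\mathfrak g$-valued Lax representation with functions $A_\alpha,B_\alpha,M,N$ and characteristic element $S_\alpha=A_\alpha-B_\alpha$, as defined in the context. Let $f$ be a symmetric ad-invariant $(k+p)$-form on the Lie algebra $\mathfrak g$. Then the tensor field $$F_{\alpha_1\alpha_2\dots\alpha_k}=f(S_{\alpha_1},S_{\alpha_2},\dots,S_{\alpha_k},\underbrace{M,M,\dots,M}_{p})$$ satisfies $$\nabla_{(\beta}F_{\alpha_1\alpha_2\dots\alpha_k)}=0,$$ i.e. $F_{\alpha_1\dots\alpha_k}$ is a Killing field.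
   Context: Greek indices range over $1,\dots,n$; repeated indices are summed. $x,y$ are the independent variables, $U^1,\dots,U^n$ the dependent variables; subscripts $x,y$ denote partial derivatives, $D_x,D_y$ are total derivatives, and a comma denotes $P_{,\alpha}=\partial P/\partial U^\alpha$. The coefficients $G^\alpha_{\beta\gamma}$ (not assumed symmetric in $\beta,\gamma$) and $Q^\alpha$ are smooth functions of $U=(U^1,\dots,U^n)$. Lax representation: $\mathfrak g$ is a (finite-dimensional) matrix Lie algebra, $A_\alpha,B_\alpha$ ($\alpha=1,\dots,n$), $M,N$ are smooth $\mathfrak g$-valued functions of $U^1,\dots,U^n$, and with $$\widetilde A=A_\alpha U^\alpha_x+\lambda M,\qquad \widetilde B=B_\alpha U^\alpha_y+\tfrac1\lambda N,\qquad S_\alpha=A_\alpha-B_\alpha,$$ the identity $D_y\widetilde A-D_x\widetilde B+[\widetilde A,\widetilde B]=S_\alpha\Delta^\alpha$ holds identically in the parameter $\lambda\neq0$ and in the variables $U^\alpha$ and their derivatives. $S_1,\dots,S_n$ (the characteristic element) are assumed linearly independent. Covariant derivative: $\nabla_\beta$ is the covariant derivative with respect to the connection with coefficients $G^\gamma_{\alpha\beta}$, with the convention $\nabla_\beta T_{\alpha_1\dots\alpha_k}=T_{\alpha_1\dots\alpha_k,\beta}-\sum_{i=1}^k G^\gamma_{\alpha_i\beta}\,T_{\alpha_1\dots\alpha_{i-1}\gamma\alpha_{i+1}\dots\alpha_k}$. Round brackets around indices denote symmetrization over all enclosed indices. A symmetric $m$-form $f$ on $\mathfrak g$ is a symmetric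 $m$-linear scalar-valued form; it is ad-invariant if $\sum_{i=1}^m f(X_1,\dots,[Y,X_i],\dots,X_m)=0$ for all $Y,X_1,\dots,X_m\in\mathfrak g$. *)

theory Defs
  imports "HOL-Analysis.Analysis" "HOL-Combinatorics.Permutations"
begin

definition partial :: "'n::finite \<Rightarrow> (real^'n \<Rightarrow> 'b::real_normed_vector) \<Rightarrow> real^'n \<Rightarrow> 'b" where
  "partial \<alpha> P u = frechet_derivative P (at u) (axis \<alpha> 1)"

primrec iterated_partial ::
  "'n::finite list \<Rightarrow> (real^'n \<Rightarrow> 'b::real_normed_vector) \<Rightarrow> real^'n \<Rightarrow> 'b" where
  "iterated_partial [] P = P"
| "iterated_partial (\<alpha> # \<alpha>s) P = partial \<alpha> (iterated_partial \<alpha>s P)"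

text \<open>On an open set this is \<open>C\<^sup>\<infinity>\<close>: differentiability of the partial derivatives of
  every order also gives their continuity.\<close>

definition smooth_on :: "(real^'n::finite) set \<Rightarrow> (real^'n \<Rightarrow> 'b::real_normed_vector) \<Rightarrow> bool" where
  "smooth_on D P \<longleftrightarrow> (\<forall>\<alpha>s. \<forall>u\<in>D. iterated_partial \<alpha>s P differentiable (at u))"

text \<open>A differential function of first order is a function \<open>P u ux uy\<close> of the independent jet
  coordinates \<open>U\<^sup>\<alpha>\<close>, \<open>U\<^sup>\<alpha>\<^sub>x\<close>, \<open>U\<^sup>\<alpha>\<^sub>y\<close>. Its total derivatives
  depend in addition on the second-order coordinates \<open>uxx\<close>, \<open>uxy\<close>, \<open>uyy\<close>.\<close>

definition total_Dx ::
  "(real^'n::finite \<Rightarrow> real^'n \<Rightarrow> real^'n \<Rightarrow> 'b::real_normed_vector) \<Rightarrow>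
   real^'n \<Rightarrow> real^'n \<Rightarrow> real^'n \<Rightarrow> real^'n \<Rightarrow> real^'n \<Rightarrow> 'b" where
  "total_Dx P u ux uy uxx uxy = (\<Sum>\<alpha>\<in>UNIV.
       (ux $ \<alpha>) *\<^sub>R partial \<alpha> (\<lambda>v. P v ux uy) u
     + (uxx $ \<alpha>) *\<^sub>R partial \<alpha> (\<lambda>v. P u v uy) ux
     + (uxy $ \<alpha>) *\<^sub>R partial \<alpha> (\<lambda>v. P u ux v) uy)"

definition total_Dy ::
  "(real^'n::finite \<Rightarrow> real^'n \<Rightarrow> real^'n \<Rightarrow> 'b::real_normed_vector) \<Rightarrow>
   real^'n \<Rightarrow> real^'n \<Rightarrow> real^'n \<Rightarrow> real^'n \<Rightarrow> real^'n \<Rightarrow> 'b" where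
  "total_Dy P u ux uy uxy uyy = (\<Sum>\<alpha>\<in>UNIV.
       (uy $ \<alpha>) *\<^sub>R partial \<alpha> (\<lambda>v. P v ux uy) u
     + (uxy $ \<alpha>) *\<^sub>R partial \<alpha> (\<lambda>v. P u v uy) ux
     + (uyy $ \<alpha>) *\<^sub>R partial \<alpha> (\<lambda>v. P u ux v) uy)"

definition bracket :: "complex^'m^'m \<Rightarrow> complex^'m^'m \<Rightarrow> complex^'m^'m::finite" where
  "bracket X Y = X ** Y - Y ** X"

text \<open>\<open>subspace\<close> refers to the real vector space structure, so this comprises real and
  complex Lie algebras of matrices alike.\<close>

definition matrix_lie_algebra :: "(complex^'m^'m::finite) set \<Rightarrow> bool" where
  "matrix_lie_algebra \<gg> \<longleftrightarrow> subspace \<gg> \<and> (\<forall>X\<in>\<gg>. \<forall>Y\<in>\<gg>. bracket X Y \<in> \<gg>)"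

text \<open>An \<open>m\<close>-form takes the list of its \<open>m\<close> arguments; its values on other lists, or on lists
  with entries outside of \<open>\<gg>\<close>, are irrelevant. Multilinearity is over the reals with
  complex values, so real forms on real algebras and complex forms on complex algebras are
  both instances.\<close>

definition symmetric_form ::
  "(complex^'m^'m::finite) set \<Rightarrow> nat \<Rightarrow> ((complex^'m^'m) list \<Rightarrow> complex) \<Rightarrow> bool" where
  "symmetric_form \<gg> m f \<longleftrightarrow>
     (\<forall>Xs i Y Z a b. length Xs = m \<and> set Xs \<subseteq> \<gg> \<and> i < m \<and> Y \<in> \<gg> \<and> Z \<in> \<gg> \<longrightarrow>
        f (Xs[i := a *\<^sub>R Y + b *\<^sub>R Z]) = a *\<^sub>R f (Xs[i := Y]) + b *\<^sub>R f (Xs[i := Z])) \<and>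
     (\<forall>Xs \<sigma>. length Xs = m \<and> set Xs \<subseteq> \<gg> \<and> \<sigma> permutes {..<m} \<longrightarrow>
        f (permute_list \<sigma> Xs) = f Xs)"

definition ad_invariant ::
  "(complex^'m^'m::finite) set \<Rightarrow> nat \<Rightarrow> ((complex^'m^'m) list \<Rightarrow> complex) \<Rightarrow> bool" where
  "ad_invariant \<gg> m f \<longleftrightarrow>
     (\<forall>Y Xs. Y \<in> \<gg> \<and> length Xs = m \<and> set Xs \<subseteq> \<gg> \<longrightarrow>
        (\<Sum>i<m. f (Xs[i := bracket Y (Xs ! i)])) = 0)"

text \<open>The coefficient \<open>G\<^sup>\<alpha>\<^sub>\<beta>\<^sub>\<gamma>\<close> is written \<open>G \<alpha> \<beta> \<gamma>\<close>, the upper index first.\<close>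

definition chiral_system ::
  "('n \<Rightarrow> 'n \<Rightarrow> 'n \<Rightarrow> real^'n \<Rightarrow> real) \<Rightarrow> ('n \<Rightarrow> real^'n \<Rightarrow> real) \<Rightarrow>
   'n::finite \<Rightarrow> real^'n \<Rightarrow> real^'n \<Rightarrow> real^'n \<Rightarrow> real^'n \<Rightarrow> real" where
  "chiral_system G Q \<alpha> u ux uy uxy =
     uxy $ \<alpha> + (\<Sum>\<beta>\<in>UNIV. \<Sum>\<gamma>\<in>UNIV. G \<alpha> \<beta> \<gamma> u * ux $ \<beta> * uy $ \<gamma>) + Q \<alpha> u"

definition lax_A ::
  "('n \<Rightarrow> real^'n \<Rightarrow> complex^'m^'m) \<Rightarrow> (real^'n \<Rightarrow> complex^'m^'m) \<Rightarrow> real \<Rightarrow>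
   real^'n::finite \<Rightarrow> real^'n \<Rightarrow> real^'n \<Rightarrow> complex^'m^'m::finite" where
  "lax_A A M lam u ux uy = (\<Sum>\<alpha>\<in>UNIV. (ux $ \<alpha>) *\<^sub>R A \<alpha> u) + lam *\<^sub>R M u"

definition lax_B ::
  "('n \<Rightarrow> real^'n \<Rightarrow> complex^'m^'m) \<Rightarrow> (real^'n \<Rightarrow> complex^'m^'m) \<Rightarrow> real \<Rightarrow>
   real^'n::finite \<Rightarrow> real^'n \<Rightarrow> real^'n \<Rightarrow> complex^'m^'m::finite" where
  "lax_B B N lam u ux uy = (\<Sum>\<alpha>\<in>UNIV. (uy $ \<alpha>) *\<^sub>R B \<alpha> u) + (1 / lam) *\<^sub>R N u"

definition char_element ::
  "('n \<Rightarrow> real^'n \<Rightarrow> complex^'m^'m) \<Rightarrow> ('n \<Rightarrow> real^'n \<Rightarrow> complex^'m^'m) \<Rightarrow>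
   'n::finite \<Rightarrow> real^'n \<Rightarrow> complex^'m^'m::finite" where
  "char_element A B \<alpha> u = A \<alpha> u - B \<alpha> u"

definition lax_representation ::
  "(real^'n) set \<Rightarrow> (complex^'m^'m) set \<Rightarrow>
   ('n \<Rightarrow> 'n \<Rightarrow> 'n \<Rightarrow> real^'n \<Rightarrow> real) \<Rightarrow> ('n \<Rightarrow> real^'n \<Rightarrow> real) \<Rightarrow>
   ('n \<Rightarrow> real^'n \<Rightarrow> complex^'m^'m) \<Rightarrow> ('n \<Rightarrow> real^'n \<Rightarrow> complex^'m^'m) \<Rightarrow>
   (real^'n::finite \<Rightarrow> complex^'m^'m) \<Rightarrow> (real^'n \<Rightarrow> complex^'m^'m::finite) \<Rightarrow> bool" where
  "lax_representation D \<gg> G Q A B M N \<longleftrightarrow>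
     (\<forall>\<alpha>. smooth_on D (A \<alpha>) \<and> smooth_on D (B \<alpha>)) \<and> smooth_on D M \<and> smooth_on D N \<and>
     (\<forall>u\<in>D. (\<forall>\<alpha>. A \<alpha> u \<in> \<gg> \<and> B \<alpha> u \<in> \<gg>) \<and> M u \<in> \<gg> \<and> N u \<in> \<gg>) \<and>
     (\<forall>lam. lam \<noteq> 0 \<longrightarrow> (\<forall>u\<in>D. \<forall>ux uy uxx uxy uyy.
        total_Dy (lax_A A M lam) u ux uy uxy uyy - total_Dx (lax_B B N lam) u ux uy uxx uxy
          + bracket (lax_A A M lam u ux uy) (lax_B B N lam u ux uy)
        = (\<Sum>\<alpha>\<in>UNIV. chiral_system G Q \<alpha> u ux uy uxy *\<^sub>R char_element A B \<alpha> u))) \<and>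
     (\<forall>u\<in>D. \<forall>c :: 'n \<Rightarrow> real.
        (\<Sum>\<alpha>\<in>UNIV. c \<alpha> *\<^sub>R char_element A B \<alpha> u) = 0 \<longrightarrow> (\<forall>\<alpha>. c \<alpha> = 0))"

text \<open>A covariant tensor field is a function of the list of its indices (its length being the
  rank) and of the point.\<close>

type_synonym ('n, 'b) tensor_field = "'n list \<Rightarrow> real^'n \<Rightarrow> 'b"

definition covariant_derivative ::
  "('n::finite \<Rightarrow> 'n \<Rightarrow> 'n \<Rightarrow> real^'n \<Rightarrow> real) \<Rightarrow> 'n \<Rightarrow>
   ('n, 'b::real_normed_vector) tensor_field \<Rightarrow> ('n, 'b) tensor_field" where
  "covariant_derivative G \<beta> T \<alpha>s u = partial \<beta> (T \<alpha>s) u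
     - (\<Sum>i<length \<alpha>s. \<Sum>\<gamma>\<in>UNIV. G \<gamma> (\<alpha>s ! i) \<beta> u *\<^sub>R T (\<alpha>s[i := \<gamma>]) u)"

text \<open>The covariant derivative as a tensor field of rank one higher; the index of
  differentiation comes first in the list.\<close>

definition nabla ::
  "('n::finite \<Rightarrow> 'n \<Rightarrow> 'n \<Rightarrow> real^'n \<Rightarrow> real) \<Rightarrow>
   ('n, 'b::real_normed_vector) tensor_field \<Rightarrow> ('n, 'b) tensor_field" where
  "nabla G T \<alpha>s = covariant_derivative G (hd \<alpha>s) T (tl \<alpha>s)"

definition symmetrization ::
  "('n::finite, 'b::real_normed_vector) tensor_field \<Rightarrow> ('n, 'b) tensor_field" where
  "symmetrization T \<alpha>s u = (1 / fact (length \<alpha>s)) *\<^sub>R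
     (\<Sum>\<sigma> | \<sigma> permutes {..<length \<alpha>s}. T (permute_list \<sigma> \<alpha>s) u)"

definition killing_field ::
  "(real^'n::finite) set \<Rightarrow> ('n \<Rightarrow> 'n \<Rightarrow> 'n \<Rightarrow> real^'n \<Rightarrow> real) \<Rightarrow> nat \<Rightarrow>
   ('n, 'b::real_normed_vector) tensor_field \<Rightarrow> bool" where
  "killing_field D G k T \<longleftrightarrow>
     (\<forall>u\<in>D. \<forall>\<beta> \<alpha>s. length \<alpha>s = k \<longrightarrow> symmetrization (nabla G T) (\<beta> # \<alpha>s) u = 0)"

end

theory Submission
  imports Defs
begin

text \<open>
  Comparing coefficients in the Lax identity gives \<open>M\<^sub>,\<^sub>\<beta> = [B\<^sub>\<beta>, M]\<close> and
  \<open>A\<^sub>\<alpha>\<^sub>,\<^sub>\<beta> - B\<^sub>\<beta>\<^sub>,\<^sub>\<alpha> + [A\<^sub>\<alpha>, B\<^sub>\<beta>] = G\<^sup>\<gamma>\<^sub>\<alpha>\<^sub>\<beta> S\<^sub>\<gamma>\<close>. Substituting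
  \<open>A\<^sub>\<alpha> = S\<^sub>\<alpha> + B\<^sub>\<alpha>\<close> turns the second relation into
  \<open>S\<^sub>\<alpha>\<^sub>,\<^sub>\<beta> - G\<^sup>\<gamma>\<^sub>\<alpha>\<^sub>\<beta> S\<^sub>\<gamma> = [B\<^sub>\<beta>, S\<^sub>\<alpha>] + C\<^sub>\<alpha>\<^sub>\<beta>\<close> with
  \<open>C\<^sub>\<alpha>\<^sub>\<beta> = B\<^sub>\<beta>\<^sub>,\<^sub>\<alpha> - B\<^sub>\<alpha>\<^sub>,\<^sub>\<beta> - [B\<^sub>\<alpha>, B\<^sub>\<beta>]\<close> antisymmetric. In \<open>\<nabla>\<^sub>\<beta> F\<close> the brackets with
  \<open>B\<^sub>\<beta>\<close> add up to zero by ad-invariance, and the terms with \<open>C\<close> vanish under symmetrization.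
\<close>

section \<open>Forms that are multilinear on a subspace\<close>

definition multilinear_on :: "'a::real_vector set \<Rightarrow> nat \<Rightarrow> ('a list \<Rightarrow> 'b::real_vector) \<Rightarrow> bool" where
  "multilinear_on V m f \<longleftrightarrow>
     (\<forall>Xs i Y Z a b. length Xs = m \<and> set Xs \<subseteq> V \<and> i < m \<and> Y \<in> V \<and> Z \<in> V \<longrightarrow>
        f (Xs[i := a *\<^sub>R Y + b *\<^sub>R Z]) = a *\<^sub>R f (Xs[i := Y]) + b *\<^sub>R f (Xs[i := Z]))"

lemma multilinear_onD:
  assumes "multilinear_on V m f" "length Xs = m" "set Xs \<subseteq> V" "i < m" "Y \<in> V" "Z \<in> V"
  shows "f (Xs[i := a *\<^sub>R Y + b *\<^sub>R Z]) = a *\<^sub>R f (Xs[i := Y]) + b *\<^sub>R f (Xs[i := Z])"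
  using assms unfolding multilinear_on_def by blast

text \<open>Freezing the first slot lowers the number of arguments by one; this drives the induction
  in \<open>has_derivative_multilinear\<close>.\<close>

lemma multilinear_on_Cons:
  assumes "multilinear_on V (Suc m) f" "b \<in> V"
  shows "multilinear_on V m (\<lambda>Xs. f (b # Xs))"
  unfolding multilinear_on_def
proof (intro allI impI, elim conjE)
  fix Xs i Y Z and r s :: real
  assume "length Xs = m" "set Xs \<subseteq> V" "i < m" "Y \<in> V" "Z \<in> V"
  then show "f (b # Xs[i := r *\<^sub>R Y + s *\<^sub>R Z])
      = r *\<^sub>R f (b # Xs[i := Y]) + s *\<^sub>R f (b # Xs[i := Z])"
    using multilinear_onD[OF assms(1), of "b # Xs" "Suc i" Y Z r s] assms(2) by simp
qed

lemma multilinear_on_add: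
  assumes "multilinear_on V m f" "length Xs = m" "set Xs \<subseteq> V" "i < m" "Y \<in> V" "Z \<in> V"
  shows "f (Xs[i := Y + Z]) = f (Xs[i := Y]) + f (Xs[i := Z])"
  using multilinear_onD[OF assms, of 1 1] by simp

lemma multilinear_on_minus:
  assumes "multilinear_on V m f" "length Xs = m" "set Xs \<subseteq> V" "i < m" "Y \<in> V"
  shows "f (Xs[i := - Y]) = - f (Xs[i := Y])"
  using multilinear_onD[OF assms assms(5), of "-1" 0] by simp

lemma multilinear_on_sum:
  assumes "multilinear_on V m f" "subspace V" "length Xs = m" "set Xs \<subseteq> V" "i < m"
    and "finite I" "\<And>j. j \<in> I \<Longrightarrow> Y j \<in> V"
  shows "f (Xs[i := \<Sum>j\<in>I. c j *\<^sub>R Y j]) = (\<Sum>j\<in>I. c j *\<^sub>R f (Xs[i := Y j]))"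
  using assms(6,7)
proof (induction I)
  case empty
  \<comment> \<open>Coefficients 0 and 0 applied to the zero vector give the value 0 for an argument
    list containing zero.\<close>
  show ?case
    using multilinear_onD[OF assms(1,3,4,5) subspace_0 subspace_0, of 0 0] assms(2) by simp
next
  case (insert j I)
  have "(\<Sum>j\<in>I. c j *\<^sub>R Y j) \<in> V"
    using insert.prems assms(2) by (auto intro!: subspace_sum subspace_scale)
  then show ?case
    using multilinear_onD[OF assms(1,3,4,5), of "Y j" "\<Sum>j\<in>I. c j *\<^sub>R Y j" "c j" 1] insert by simp
qed

section \<open>Differentiation of maps into a subspace and of multilinear expressions in
  them\<close>

lemma subspace_orthonormal_expansion:
  fixes V :: "'a::euclidean_space set"
  assumes "subspace V"
  obtains E where "finite E" "E \<subseteq> V" "\<And>x. x \<in> V \<Longrightarrow> (\<Sum>e\<in>E. (e \<bullet> x) *\<^sub>R e) = x"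
proof (rule orthonormal_basis_subspace[OF assms])
  fix E assume E: "E \<subseteq> V" "pairwise orthogonal E" "\<And>x. x \<in> E \<Longrightarrow> norm x = 1"
    "independent E" "span E = V"
  have fin: "finite E" using E(4) independent_bound by blast
  show thesis
  proof (rule that[OF fin E(1)])
    fix x assume "x \<in> V"
    then show "(\<Sum>e\<in>E. (e \<bullet> x) *\<^sub>R e) = x"
      using orthonormal_basis_expand[OF E(2,3) _ fin, of x] E(5) by (simp add: inner_commute)
  qed
qed

text \<open>Near \<open>u\<close> the map agrees with its expansion in an orthonormal basis of
  \<open>V\<close>. Differentiating that expansion gives a combination of basis vectors, and by
  uniqueness it is the derivative of \<open>F\<close>.\<close>

lemma has_derivative_in_subspace:
  fixes F :: "'c::real_normed_vector \<Rightarrow> 'a::euclidean_space"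
  assumes V: "subspace V" and D: "open D" "u \<in> D" and F: "(F has_derivative F') (at u)"
    and FV: "\<And>v. v \<in> D \<Longrightarrow> F v \<in> V"
  shows "F' h \<in> V"
proof -
  obtain E where E: "finite E" "E \<subseteq> V" "\<And>x. x \<in> V \<Longrightarrow> (\<Sum>e\<in>E. (e \<bullet> x) *\<^sub>R e) = x"
    using subspace_orthonormal_expansion[OF V] by blast
  have "((\<lambda>v. \<Sum>e\<in>E. (e \<bullet> F v) *\<^sub>R e) has_derivative (\<lambda>h. \<Sum>e\<in>E. (e \<bullet> F' h) *\<^sub>R e)) (at u)"
    by (auto intro!: derivative_eq_intros F)
  then have "(F has_derivative (\<lambda>h. \<Sum>e\<in>E. (e \<bullet> F' h) *\<^sub>R e)) (at u)"
    by (rule has_derivative_transform_within_open[OF _ D]) (simp add: E(3) FV)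
  then have "F' = (\<lambda>h. \<Sum>e\<in>E. (e \<bullet> F' h) *\<^sub>R e)"
    using F has_derivative_unique by blast
  then have "F' h = (\<Sum>e\<in>E. (e \<bullet> F' h) *\<^sub>R e)" by meson
  also have "\<dots> \<in> V" using E(2) V by (auto intro!: subspace_sum subspace_scale)
  finally show ?thesis .
qed

text \<open>By induction on the number of slots: expanding the first argument in an orthonormal basis of
  the subspace reduces the claim to the product rule for a scalar factor.\<close>

lemma has_derivative_multilinear:
  fixes f :: "'a::euclidean_space list \<Rightarrow> 'b::real_normed_vector"
    and X :: "nat \<Rightarrow> 'c::real_normed_vector \<Rightarrow> 'a"
  assumes V: "subspace V" and D: "open D" "u \<in> D"
    and "multilinear_on V m f"
    and "\<And>i. i < m \<Longrightarrow> (X i has_derivative X' i) (at u)"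
    and "\<And>i v. i < m \<Longrightarrow> v \<in> D \<Longrightarrow> X i v \<in> V"
  shows "((\<lambda>v. f (map (\<lambda>i. X i v) [0..<m])) has_derivative
     (\<lambda>h. \<Sum>i<m. f ((map (\<lambda>i. X i u) [0..<m])[i := X' i h]))) (at u)"
  using assms(4-6)
proof (induction m arbitrary: f X X')
  case 0
  show ?case by simp
next
  case (Suc m)
  obtain E where E: "finite E" "E \<subseteq> V" "\<And>x. x \<in> V \<Longrightarrow> (\<Sum>e\<in>E. (e \<bullet> x) *\<^sub>R e) = x"
    using subspace_orthonormal_expansion[OF V] by blast
  define R where "R v = map (\<lambda>i. X (Suc i) v) [0..<m]" for v
  have R: "length (R v) = m" for v by (simp add: R_def)
  have RV: "set (R v) \<subseteq> V" if "v \<in> D" for v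
    using Suc.prems(3) that by (auto simp: R_def)
  have split: "map (\<lambda>i. X i v) [0..<Suc m] = X 0 v # R v" for v
    unfolding R_def by (rule map_upt_Suc)
  \<comment> \<open>The basis vectors lie in \<open>V\<close>, the only place where \<open>f\<close>
    is known to be linear.\<close>
  have head: "f (x # Ys) = (\<Sum>e\<in>E. (e \<bullet> x) *\<^sub>R f (e # Ys))"
    if "x \<in> V" "length Ys = m" "set Ys \<subseteq> V" for x Ys
  proof -
    have "f ((x # Ys)[0 := \<Sum>e\<in>E. (e \<bullet> x) *\<^sub>R e]) = (\<Sum>e\<in>E. (e \<bullet> x) *\<^sub>R f ((x # Ys)[0 := e]))"
      using that E by (intro multilinear_on_sum[OF Suc.prems(1) V]) auto
    then show ?thesis using E(3)[OF that(1)] by simp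
  qed
  have X'V: "X' i h \<in> V" if "i < Suc m" for i h
    using has_derivative_in_subspace[OF V D Suc.prems(2)[OF that]] Suc.prems(3) that by blast
  \<comment> \<open>The induction hypothesis for the form with first argument \<open>e\<close> and
    the family shifted by one slot.\<close>
  have "((\<lambda>v. f (e # R v)) has_derivative (\<lambda>h. \<Sum>i<m. f (e # (R u)[i := X' (Suc i) h]))) (at u)"
    if "e \<in> E" for e
    unfolding R_def
    using that E(2) Suc.prems
    by (intro Suc.IH[OF multilinear_on_Cons]) auto
  then have "((\<lambda>v. \<Sum>e\<in>E. (e \<bullet> X 0 v) *\<^sub>R f (e # R v)) has_derivative
      (\<lambda>h. \<Sum>e\<in>E. (e \<bullet> X 0 u) *\<^sub>R (\<Sum>i<m. f (e # (R u)[i := X' (Suc i) h]))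
          + (e \<bullet> X' 0 h) *\<^sub>R f (e # R u))) (at u)"
    using Suc.prems(2)[of 0]
    by (intro has_derivative_sum has_derivative_scaleR has_derivative_inner_right) auto
  then have "((\<lambda>v. f (X 0 v # R v)) has_derivative
      (\<lambda>h. \<Sum>e\<in>E. (e \<bullet> X 0 u) *\<^sub>R (\<Sum>i<m. f (e # (R u)[i := X' (Suc i) h]))
          + (e \<bullet> X' 0 h) *\<^sub>R f (e # R u))) (at u)"
    by (rule has_derivative_transform_within_open[OF _ D])
      (metis head R RV Suc.prems(3) zero_less_Suc)
  \<comment> \<open>The derivative of the coefficient \<open>e \<bullet> X 0 v\<close> reassembles
    to the term of slot 0; the remaining terms reassemble to those of the slots
    \<open>Suc i\<close>.\<close>
  moreover have "(\<Sum>e\<in>E. (e \<bullet> X 0 u) *\<^sub>R (\<Sum>i<m. f (e # (R u)[i := X' (Suc i) h]))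
          + (e \<bullet> X' 0 h) *\<^sub>R f (e # R u))
      = (\<Sum>i<Suc m. f ((X 0 u # R u)[i := X' i h]))" for h
  proof -
    have "(\<Sum>e\<in>E. (e \<bullet> X 0 u) *\<^sub>R (\<Sum>i<m. f (e # (R u)[i := X' (Suc i) h])))
        = (\<Sum>i<m. \<Sum>e\<in>E. (e \<bullet> X 0 u) *\<^sub>R f (e # (R u)[i := X' (Suc i) h]))"
      unfolding scaleR_sum_right by (rule sum.swap)
    also have "\<dots> = (\<Sum>i<m. f (X 0 u # (R u)[i := X' (Suc i) h]))"
    proof (intro sum.cong refl head[symmetric])
      fix i assume "i \<in> {..<m}"
      then show "set ((R u)[i := X' (Suc i) h]) \<subseteq> V"
        using RV[OF D(2)] X'V[of "Suc i" h] by (intro set_update_subsetI) auto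
    qed (use R Suc.prems(3) D in auto)
    finally show ?thesis
      using head[OF X'V[of 0 h] R RV[OF D(2)]]
      by (simp add: sum.distrib sum.lessThan_Suc_shift del: sum.lessThan_Suc)
  qed
  ultimately show ?case unfolding split by simp
qed

section \<open>Commutators, partial derivatives and extraction of coefficients\<close>

lemma bracket_add_left: "bracket (X + Y) Z = bracket X Z + bracket Y Z"
  and bracket_add_right: "bracket Z (X + Y) = bracket Z X + bracket Z Y"
  and bracket_scaleR_left: "bracket (c *\<^sub>R X) Z = c *\<^sub>R bracket X Z"
  and bracket_scaleR_right: "bracket Z (c *\<^sub>R X) = c *\<^sub>R bracket Z X"
  and bracket_anticommute: "bracket X Z = - bracket Z X"
  by (simp_all add: bracket_def vec_eq_iff matrix_matrix_mult_def algebra_simps sum.distrib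
      sum_distrib_left sum_subtractf scaleR_right_diff_distrib scaleR_sum_right)

lemma partial_eqI:
  assumes "(P has_derivative P') (at u)"
  shows "partial \<alpha> P u = P' (axis \<alpha> 1)"
  using frechet_derivative_at[OF assms] by (simp add: partial_def)

lemma smooth_on_has_derivative:
  assumes "smooth_on D P" "u \<in> D"
  shows "(P has_derivative frechet_derivative P (at u)) (at u)"
proof -
  have "iterated_partial [] P differentiable (at u)"
    using assms unfolding smooth_on_def by blast
  then show ?thesis by (simp add: frechet_derivative_works)
qed

text \<open>Setting a jet vector to a unit vector isolates one coefficient of a form linear in
  it.\<close>

lemma sum_axis_scaleR:
  fixes X :: "'n::finite \<Rightarrow> 'a::real_vector"
  shows "(\<Sum>\<beta>\<in>UNIV. (axis \<gamma> (1::real) $ \<beta>) *\<^sub>R X \<beta>) = X \<gamma>"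
proof -
  have "(axis \<gamma> (1::real) $ \<beta>) *\<^sub>R X \<beta> = (if \<beta> = \<gamma> then X \<beta> else 0)" for \<beta>
    by (simp add: axis_def)
  then show ?thesis by simp
qed

text \<open>This replaces comparison of powers of the spectral parameter. The values 1 and -1 serve
  for both \<open>lam\<close> and \<open>1 / lam\<close>, which coincide there.\<close>

lemma affine_eq_at_1_minus_1:
  fixes a b :: "'a::real_vector"
  assumes "a + (1::real) *\<^sub>R b = c" "a + (-1::real) *\<^sub>R b = c"
  shows "b = 0"
proof -
  have "b = - b" by (rule add_left_imp_eq[of a]) (use assms in simp)
  then have "2 *\<^sub>R b = 0" unfolding scaleR_2 by (metis add.right_inverse)
  then show ?thesis by simp
qed

section \<open>Coefficients of the Lax identity\<close>

lemma total_Dy_lax_A: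
  assumes "\<And>\<alpha>. smooth_on D (A \<alpha>)" "smooth_on D M" "u \<in> D"
  shows "total_Dy (lax_A A M lam) u ux uy uxy uyy
    = (\<Sum>\<gamma>\<in>UNIV. (uy $ \<gamma>) *\<^sub>R ((\<Sum>\<beta>\<in>UNIV. (ux $ \<beta>) *\<^sub>R partial \<gamma> (A \<beta>) u) + lam *\<^sub>R partial \<gamma> M u)
        + (uxy $ \<gamma>) *\<^sub>R A \<gamma> u)"
proof -
  have 1: "partial \<gamma> (\<lambda>v. lax_A A M lam v ux uy) u
      = (\<Sum>\<beta>\<in>UNIV. (ux $ \<beta>) *\<^sub>R partial \<gamma> (A \<beta>) u) + lam *\<^sub>R partial \<gamma> M u" for \<gamma>
    unfolding lax_A_def partial_def[of _ "A _"] partial_def[of _ M]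
    by (rule partial_eqI) (auto intro!: derivative_eq_intros smooth_on_has_derivative assms)
  have "partial \<gamma> (\<lambda>v. lax_A A M lam u v uy) ux = (\<Sum>\<beta>\<in>UNIV. (axis \<gamma> (1::real) $ \<beta>) *\<^sub>R A \<beta> u)" for \<gamma>
    unfolding lax_A_def
    by (rule partial_eqI)
      (auto intro!: derivative_eq_intros bounded_linear.has_derivative[OF bounded_linear_vec_nth])
  then have 2: "partial \<gamma> (\<lambda>v. lax_A A M lam u v uy) ux = A \<gamma> u" for \<gamma>
    by (simp add: sum_axis_scaleR)
  have 3: "partial \<gamma> (\<lambda>v. lax_A A M lam u ux v) uy = 0" for \<gamma>
    unfolding lax_A_def by (rule partial_eqI) (rule has_derivative_const)
  show ?thesis unfolding total_Dy_def 1 2 3 by simp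
qed

text \<open>Exchanging x with y and \<open>lam\<close> with \<open>1 / lam\<close> carries
  \<open>lax_B\<close> into \<open>lax_A\<close>, so the previous computation applies.\<close>

lemma total_Dx_lax_B:
  assumes "\<And>\<alpha>. smooth_on D (B \<alpha>)" "smooth_on D N" "u \<in> D"
  shows "total_Dx (lax_B B N lam) u ux uy uxx uxy
    = (\<Sum>\<beta>\<in>UNIV. (ux $ \<beta>) *\<^sub>R ((\<Sum>\<gamma>\<in>UNIV. (uy $ \<gamma>) *\<^sub>R partial \<beta> (B \<gamma>) u) + (1 / lam) *\<^sub>R partial \<beta> N u)
        + (uxy $ \<beta>) *\<^sub>R B \<beta> u)"
proof -
  have swap: "total_Dx (lax_B B N lam) u ux uy uxx uxy = total_Dy (lax_A B N (1 / lam)) u uy ux uxy uxx"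
    unfolding total_Dx_def total_Dy_def lax_A_def lax_B_def by (simp add: algebra_simps)
  show ?thesis unfolding swap by (rule total_Dy_lax_A[OF assms])
qed

text \<open>Each jet coordinate stands as a scalar before its own sum, and the sums over
  \<open>G\<close> are nested accordingly, so that \<open>sum_axis_scaleR\<close> applies once unit
  vectors are inserted.\<close>

lemma lax_identity:
  assumes lax: "lax_representation D \<gg> G Q A B M N" and u: "u \<in> D" and lam: "lam \<noteq> 0"
  shows "(\<Sum>\<gamma>\<in>UNIV. (uy $ \<gamma>) *\<^sub>R ((\<Sum>\<beta>\<in>UNIV. (ux $ \<beta>) *\<^sub>R partial \<gamma> (A \<beta>) u) + lam *\<^sub>R partial \<gamma> M u))
    - (\<Sum>\<beta>\<in>UNIV. (ux $ \<beta>) *\<^sub>R ((\<Sum>\<gamma>\<in>UNIV. (uy $ \<gamma>) *\<^sub>R partial \<beta> (B \<gamma>) u) + (1 / lam) *\<^sub>R partial \<beta> N u))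
    + bracket ((\<Sum>\<beta>\<in>UNIV. (ux $ \<beta>) *\<^sub>R A \<beta> u) + lam *\<^sub>R M u)
        ((\<Sum>\<gamma>\<in>UNIV. (uy $ \<gamma>) *\<^sub>R B \<gamma> u) + (1 / lam) *\<^sub>R N u)
    = (\<Sum>\<alpha>\<in>UNIV. ((\<Sum>\<beta>\<in>UNIV. (ux $ \<beta>) *\<^sub>R (\<Sum>\<gamma>\<in>UNIV. (uy $ \<gamma>) *\<^sub>R G \<alpha> \<beta> \<gamma> u)) + Q \<alpha> u)
        *\<^sub>R char_element A B \<alpha> u)"
proof -
  have sm: "\<And>\<alpha>. smooth_on D (A \<alpha>)" "\<And>\<alpha>. smooth_on D (B \<alpha>)" "smooth_on D M" "smooth_on D N"
    using lax unfolding lax_representation_def by blast+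
  \<comment> \<open>The second-order coordinates carry no further information, since the coefficient of \<open>uxy\<close> only
    returns the definition of the characteristic element.\<close>
  have "total_Dy (lax_A A M lam) u ux uy 0 0 - total_Dx (lax_B B N lam) u ux uy 0 0
          + bracket (lax_A A M lam u ux uy) (lax_B B N lam u ux uy)
        = (\<Sum>\<alpha>\<in>UNIV. chiral_system G Q \<alpha> u ux uy 0 *\<^sub>R char_element A B \<alpha> u)"
    using lax u lam unfolding lax_representation_def by blast
  then show ?thesis
    unfolding total_Dy_lax_A[OF sm(1,3) u] total_Dx_lax_B[OF sm(2,4) u]
    by (simp add: lax_A_def lax_B_def chiral_system_def sum_distrib_left mult_ac)
qed

lemma lax_representation_partial_M:
  assumes "lax_representation D \<gg> G Q A B M N" "u \<in> D"
  shows "partial \<gamma> M u = bracket (B \<gamma> u) (M u)"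
proof -
  \<comment> \<open>Here \<open>uy\<close> is a unit vector and \<open>ux = 0\<close>, which removes
    \<open>A\<close>, the derivatives of \<open>B\<close> and \<open>N\<close>, and
    \<open>G\<close>.\<close>
  have E: "lam *\<^sub>R partial \<gamma> M u + bracket (lam *\<^sub>R M u) (B \<gamma> u + (1 / lam) *\<^sub>R N u)
    = (\<Sum>\<alpha>\<in>UNIV. Q \<alpha> u *\<^sub>R char_element A B \<alpha> u)" if "lam \<noteq> 0" for lam
    using lax_identity[OF assms that, of "axis \<gamma> 1" 0] unfolding sum_axis_scaleR by simp
  \<comment> \<open>The factors \<open>lam\<close> and \<open>1 / lam\<close> cancel in the bracket
    of \<open>M\<close> with \<open>N\<close>, so the left side is affine in
    \<open>lam\<close>.\<close>
  have split: "lam *\<^sub>R partial \<gamma> M u + bracket (lam *\<^sub>R M u) (B \<gamma> u + (1 / lam) *\<^sub>R N u)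
      = bracket (M u) (N u) + lam *\<^sub>R (partial \<gamma> M u + bracket (M u) (B \<gamma> u))" if "lam \<noteq> 0" for lam
    using that by (simp add: bracket_scaleR_left bracket_scaleR_right bracket_add_right
        scaleR_add_right add_ac)
  have "partial \<gamma> M u + bracket (M u) (B \<gamma> u) = 0"
    by (rule affine_eq_at_1_minus_1; rule trans[OF split[symmetric] E]) simp_all
  then show ?thesis
    using bracket_anticommute[of "M u" "B \<gamma> u"] by (simp add: eq_neg_iff_add_eq_0)
qed

lemma lax_representation_connection:
  assumes "lax_representation D \<gg> G Q A B M N" "u \<in> D"
  shows "(\<Sum>\<alpha>\<in>UNIV. G \<alpha> \<beta> \<gamma> u *\<^sub>R char_element A B \<alpha> u)
    = partial \<gamma> (A \<beta>) u - partial \<beta> (B \<gamma>) u + bracket (A \<beta> u) (B \<gamma> u)"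
proof -
  define K where "K = (\<Sum>\<alpha>\<in>UNIV. G \<alpha> \<beta> \<gamma> u *\<^sub>R char_element A B \<alpha> u)"
  define L where "L = (\<Sum>\<alpha>\<in>UNIV. Q \<alpha> u *\<^sub>R char_element A B \<alpha> u)"
  have L: "lam *\<^sub>R partial \<gamma> M u + bracket (lam *\<^sub>R M u) (B \<gamma> u + (1 / lam) *\<^sub>R N u) = L"
    if "lam \<noteq> 0" for lam
    using lax_identity[OF assms that, of "axis \<gamma> 1" 0] unfolding sum_axis_scaleR L_def by simp
  \<comment> \<open>Both jet vectors are now unit vectors; the part independent of \<open>ux\<close>
    is again \<open>L\<close>.\<close>
  have E: "partial \<gamma> (A \<beta>) u + lam *\<^sub>R partial \<gamma> M u - (partial \<beta> (B \<gamma>) u + (1 / lam) *\<^sub>R partial \<beta> N u)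
      + bracket (A \<beta> u + lam *\<^sub>R M u) (B \<gamma> u + (1 / lam) *\<^sub>R N u) = K + L" if "lam \<noteq> 0" for lam
    using lax_identity[OF assms that, of "axis \<gamma> 1" "axis \<beta> 1"]
    unfolding sum_axis_scaleR K_def L_def by (simp add: scaleR_left_distrib sum.distrib)
  have P: "partial \<gamma> (A \<beta>) u - partial \<beta> (B \<gamma>) u + bracket (A \<beta> u) (B \<gamma> u)
      + (1 / lam) *\<^sub>R (bracket (A \<beta> u) (N u) - partial \<beta> N u) = K" if "lam \<noteq> 0" for lam
    \<comment> \<open>Only brackets with \<open>A \<beta> u\<close> are expanded; the bracket with
      \<open>M\<close> stays in the form in which \<open>L\<close> cancels it.\<close>
    using E[OF that] L[OF that]
    unfolding bracket_add_left[of "A \<beta> u"] bracket_add_right[of "A \<beta> u"] bracket_scaleR_right[of "A \<beta> u"]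
    by (simp add: algebra_simps)
  have "bracket (A \<beta> u) (N u) - partial \<beta> N u = 0"
    using P[of 1] P[of "-1"]
    by (intro affine_eq_at_1_minus_1[of "partial \<gamma> (A \<beta>) u - partial \<beta> (B \<gamma>) u + bracket (A \<beta> u) (B \<gamma> u)" _ K]) simp_all
  then show ?thesis using P[of 1] unfolding K_def by simp
qed

section \<open>Vanishing of symmetrizations by antisymmetry\<close>

lemma symmetrization_eq_0:
  fixes T :: "('n::finite, 'b::real_normed_vector) tensor_field"
  assumes "length \<alpha>s = Suc k"
    and T: "\<And>\<alpha>s. length \<alpha>s = Suc k \<Longrightarrow> T \<alpha>s u = (\<Sum>i<k. H i \<alpha>s)"
    and H: "\<And>i \<alpha>s. i < k \<Longrightarrow> length \<alpha>s = Suc k \<Longrightarrow>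
      H i (permute_list (Transposition.transpose 0 (Suc i)) \<alpha>s) = - H i \<alpha>s"
  shows "symmetrization T \<alpha>s u = 0"
proof -
  let ?P = "{\<sigma>. \<sigma> permutes {..<Suc k}}"
  have "(\<Sum>\<sigma>\<in>?P. H i (permute_list \<sigma> \<alpha>s)) = 0" if "i < k" for i
  proof -
    let ?t = "Transposition.transpose 0 (Suc i)"
    have t: "?t permutes {..<Suc k}" using that by (intro permutes_swap_id) auto
    \<comment> \<open>Composing with the transposition only reorders the permutations, yet it flips
      the sign of every term, so the sum equals its own negative.\<close>
    have "(\<Sum>\<sigma>\<in>?P. H i (permute_list \<sigma> \<alpha>s)) = (\<Sum>\<sigma>\<in>?P. H i (permute_list (\<sigma> \<circ> ?t) \<alpha>s))"
      by (rule sum_permutations_compose_right[OF t])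
    also have "\<dots> = (\<Sum>\<sigma>\<in>?P. - H i (permute_list \<sigma> \<alpha>s))"
      using t that assms(1) by (intro sum.cong refl) (simp add: permute_list_compose H)
    finally have "2 *\<^sub>R (\<Sum>\<sigma>\<in>?P. H i (permute_list \<sigma> \<alpha>s)) = 0"
      by (simp add: sum_negf scaleR_2 eq_neg_iff_add_eq_0)
    then show ?thesis by simp
  qed
  then have "(\<Sum>i<k. \<Sum>\<sigma>\<in>?P. H i (permute_list \<sigma> \<alpha>s)) = 0" by simp
  then show ?thesis
    using assms(1) by (simp add: symmetrization_def T sum.swap[of _ "{..<k}"])
qed

section \<open>The Killing equation\<close>

lemma bracket_in_lie_algebra:
  assumes "matrix_lie_algebra \<gg>" "X \<in> \<gg>" "Y \<in> \<gg>"
  shows "bracket X Y \<in> \<gg>"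
  using assms unfolding matrix_lie_algebra_def by blast


theorem proposition1:
  fixes D :: "(real^'n::finite) set"
    and \<gg> :: "(complex^'m^'m::finite) set"
    and G :: "'n \<Rightarrow> 'n \<Rightarrow> 'n \<Rightarrow> real^'n \<Rightarrow> real"
    and Q :: "'n \<Rightarrow> real^'n \<Rightarrow> real"
    and A B :: "'n \<Rightarrow> real^'n \<Rightarrow> complex^'m^'m"
    and M N :: "real^'n \<Rightarrow> complex^'m^'m"
    and f :: "(complex^'m^'m) list \<Rightarrow> complex"
    and k p :: nat
  assumes "k \<ge> 1"
    and "open D"
    and "matrix_lie_algebra \<gg>"
    and "\<And>\<alpha> \<beta> \<gamma>. smooth_on D (G \<alpha> \<beta> \<gamma>)"
    and "\<And>\<alpha>. smooth_on D (Q \<alpha>)"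
    and "lax_representation D \<gg> G Q A B M N"
    and "symmetric_form \<gg> (k + p) f"
    and "ad_invariant \<gg> (k + p) f"
  shows "killing_field D G k
    (\<lambda>\<alpha>s u. f (map (\<lambda>\<alpha>. char_element A B \<alpha> u) \<alpha>s @ replicate p (M u)))"
proof -
  let ?S = "char_element A B"
  define F where "F = (\<lambda>\<alpha>s u. f (map (\<lambda>\<alpha>. ?S \<alpha> u) \<alpha>s @ replicate p (M u)))"
  \<comment> \<open>Up to sign, the curvature of the connection \<partial> - B.\<close>
  define C where "C u \<alpha> \<beta> = partial \<alpha> (B \<beta>) u - partial \<beta> (B \<alpha>) u - bracket (B \<alpha> u) (B \<beta> u)"
    for u \<alpha> \<beta>
  \<comment> \<open>The part of the covariant derivative that survives ad-invariance, in slot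
    \<open>i\<close>: the head of the list is the index of differentiation, the tail holds the
    tensor indices.\<close>
  define H where "H u i \<alpha>s = f ((map (\<lambda>\<alpha>. ?S \<alpha> u) (tl \<alpha>s) @ replicate p (M u))[i := C u (tl \<alpha>s ! i) (hd \<alpha>s)])"
    for u i \<alpha>s
  note lie = assms(3) and lax = assms(6)
  have V: "subspace \<gg>" using lie unfolding matrix_lie_algebra_def by blast
  have mf: "multilinear_on \<gg> (k + p) f"
    using assms(7) unfolding symmetric_form_def multilinear_on_def by blast
  have sm: "\<And>\<alpha>. smooth_on D (A \<alpha>)" "\<And>\<alpha>. smooth_on D (B \<alpha>)" "smooth_on D M"
    using lax unfolding lax_representation_def by blast+
  have mem: "A \<alpha> u \<in> \<gg>" "B \<alpha> u \<in> \<gg>" "M u \<in> \<gg>" if "u \<in> D" for \<alpha> u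
    using lax that unfolding lax_representation_def by blast+
  have Smem: "?S \<alpha> u \<in> \<gg>" if "u \<in> D" for \<alpha> u
    unfolding char_element_def using mem[OF that] V by (blast intro: subspace_diff)
  have Sder: "(?S \<alpha> has_derivative (\<lambda>h. frechet_derivative (A \<alpha>) (at u) h - frechet_derivative (B \<alpha>) (at u) h)) (at u)"
    if "u \<in> D" for \<alpha> u
    unfolding char_element_def[abs_def]
    using that sm by (intro has_derivative_diff smooth_on_has_derivative)
  have Spart: "partial \<beta> (?S \<alpha>) u = partial \<beta> (A \<alpha>) u - partial \<beta> (B \<alpha>) u" if "u \<in> D" for \<alpha> \<beta> u
    unfolding partial_eqI[OF Sder[OF that]] by (simp add: partial_def)
  have Bmem: "partial \<beta> (B \<alpha>) u \<in> \<gg>" if "u \<in> D" for \<alpha> \<beta> u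
    unfolding partial_def using that
    by (intro has_derivative_in_subspace[OF V assms(2) that smooth_on_has_derivative[OF sm(2) that]] mem)
  \<comment> \<open>Needed because \<open>f\<close> is multilinear only for arguments in
    \<gg>.\<close>
  have Cmem: "C u \<alpha> \<beta> \<in> \<gg>" if "u \<in> D" for u \<alpha> \<beta>
    unfolding C_def using that V
    by (intro subspace_diff Bmem bracket_in_lie_algebra[OF lie] mem)
  have C_anti: "C u \<beta> \<alpha> = - C u \<alpha> \<beta>" for u \<alpha> \<beta>
    unfolding C_def using bracket_anticommute[of "B \<alpha> u"] by simp
  have S_cov: "partial \<beta> (?S \<alpha>) u
      = C u \<alpha> \<beta> + bracket (B \<beta> u) (?S \<alpha> u) + (\<Sum>\<gamma>\<in>UNIV. G \<gamma> \<alpha> \<beta> u *\<^sub>R ?S \<gamma> u)"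
    if "u \<in> D" for u \<alpha> \<beta>
  proof -
    have A: "A \<alpha> u = ?S \<alpha> u + B \<alpha> u" by (simp add: char_element_def)
    show ?thesis
      unfolding Spart[OF that] lax_representation_connection[OF lax that] C_def
      by (simp add: A bracket_add_left bracket_anticommute[of "?S \<alpha> u"])
  qed
  have nabla_F: "nabla G F \<alpha>s u = (\<Sum>i<k. H u i \<alpha>s)" if u: "u \<in> D" and len: "length \<alpha>s = Suc k" for u \<alpha>s
  proof -
    obtain \<beta> as where as: "\<alpha>s = \<beta> # as" "length as = k"
      using len by (metis length_Suc_conv)
    \<comment> \<open>All \<open>k + p\<close> arguments become one indexed family of functions of
      the point, as \<open>has_derivative_multilinear\<close> requires.\<close>
    define X where "X i = (if i < k then ?S (as ! i) else M)" for i
    define X' where "X' i = frechet_derivative (X i) (at u)" for i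
    define W where "W = map (\<lambda>\<alpha>. ?S \<alpha> u) as @ replicate p (M u)"
    have args: "map (\<lambda>\<alpha>. ?S \<alpha> v) as @ replicate p (M v) = map (\<lambda>i. X i v) [0..<k + p]" for v
      by (rule nth_equalityI) (auto simp: as X_def nth_append)
    have W: "length W = k + p" "set W \<subseteq> \<gg>"
      using as Smem mem u by (auto simp: W_def)
    have Xmem: "X i v \<in> \<gg>" if "v \<in> D" for i v
      using that Smem mem by (simp add: X_def)
    have Xder: "(X i has_derivative X' i) (at u)" for i
    proof -
      have "\<exists>F'. (X i has_derivative F') (at u)"
        using Sder[OF u] smooth_on_has_derivative[OF sm(3) u] unfolding X_def by auto
      then show ?thesis
        unfolding X'_def by (metis frechet_derivative_at)
    qed
    have "((\<lambda>v. F as v) has_derivative (\<lambda>h. \<Sum>i<k+p. f (W[i := X' i h]))) (at u)"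
      unfolding F_def W_def args
      by (rule has_derivative_multilinear[OF V assms(2) u mf Xder Xmem])
    then have "partial \<beta> (F as) u = (\<Sum>i<k+p. f (W[i := partial \<beta> (X i) u]))"
      unfolding X'_def by (subst partial_eqI) (auto simp: partial_def)
    also have "\<dots> = (\<Sum>i<k. f (W[i := partial \<beta> (?S (as ! i)) u])) + (\<Sum>i=k..<k+p. f (W[i := partial \<beta> M u]))"
      by (simp add: X_def lessThan_atLeast0 sum.atLeastLessThan_concat[of 0 k "k + p", symmetric])
    \<comment> \<open>By \<open>S_cov\<close> each slot holding S contributes a curvature term, a
      bracket with \<open>B \<beta> u\<close> and a connection term.\<close>
    also have "(\<Sum>i<k. f (W[i := partial \<beta> (?S (as ! i)) u])) =
        (\<Sum>i<k. H u i \<alpha>s + f (W[i := bracket (B \<beta> u) (W ! i)]) + (\<Sum>\<gamma>\<in>UNIV. G \<gamma> (as ! i) \<beta> u *\<^sub>R F (as[i := \<gamma>]) u))"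
    proof (intro sum.cong refl)
      fix i assume "i \<in> {..<k}"
      then have i: "i < k" "i < k + p" by auto
      have Wi: "W ! i = ?S (as ! i) u" using i by (simp add: W_def nth_append as)
      have br: "bracket (B \<beta> u) (W ! i) \<in> \<gg>"
        unfolding Wi by (intro bracket_in_lie_algebra[OF lie] mem Smem u)
      have GS: "(\<Sum>\<gamma>\<in>UNIV. G \<gamma> (as ! i) \<beta> u *\<^sub>R ?S \<gamma> u) \<in> \<gg>"
        using V Smem[OF u] by (intro subspace_sum subspace_scale) auto
      have "f (W[i := partial \<beta> (?S (as ! i)) u]) = f (W[i := C u (as ! i) \<beta>]) + f (W[i := bracket (B \<beta> u) (W ! i)])
          + f (W[i := \<Sum>\<gamma>\<in>UNIV. G \<gamma> (as ! i) \<beta> u *\<^sub>R ?S \<gamma> u])"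
        unfolding S_cov[OF u] Wi[symmetric]
        using multilinear_on_add[OF mf W i(2)] Cmem[OF u] br GS subspace_add[OF V] by simp
      also have "f (W[i := \<Sum>\<gamma>\<in>UNIV. G \<gamma> (as ! i) \<beta> u *\<^sub>R ?S \<gamma> u])
          = (\<Sum>\<gamma>\<in>UNIV. G \<gamma> (as ! i) \<beta> u *\<^sub>R f (W[i := ?S \<gamma> u]))"
        using Smem[OF u] by (intro multilinear_on_sum[OF mf V W i(2)]) auto
      also have "\<dots> = (\<Sum>\<gamma>\<in>UNIV. G \<gamma> (as ! i) \<beta> u *\<^sub>R F (as[i := \<gamma>]) u)"
        using i as by (simp add: F_def W_def map_update list_update_append)
      finally show "f (W[i := partial \<beta> (?S (as ! i)) u]) = H u i \<alpha>s + f (W[i := bracket (B \<beta> u) (W ! i)])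
          + (\<Sum>\<gamma>\<in>UNIV. G \<gamma> (as ! i) \<beta> u *\<^sub>R F (as[i := \<gamma>]) u)"
        by (simp add: H_def W_def as)
    qed
    \<comment> \<open>In the slots holding \<open>M\<close> the derivative is purely a bracket with
      \<open>B \<beta> u\<close>.\<close>
    also have "(\<Sum>i=k..<k+p. f (W[i := partial \<beta> M u])) = (\<Sum>i=k..<k+p. f (W[i := bracket (B \<beta> u) (W ! i)]))"
      by (intro sum.cong refl)
        (auto simp: W_def nth_append as lax_representation_partial_M[OF lax u])
    \<comment> \<open>The connection terms complete the covariant derivative, while the brackets
      from both ranges of slots join to the full sum of ad-invariance.\<close>
    finally have "partial \<beta> (F as) u - (\<Sum>i<k. \<Sum>\<gamma>\<in>UNIV. G \<gamma> (as ! i) \<beta> u *\<^sub>R F (as[i := \<gamma>]) u)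
        = (\<Sum>i<k. H u i \<alpha>s) + (\<Sum>i<k+p. f (W[i := bracket (B \<beta> u) (W ! i)]))"
      by (simp add: sum.distrib lessThan_atLeast0 sum.atLeastLessThan_concat[of 0 k "k + p", symmetric])
    also have "(\<Sum>i<k+p. f (W[i := bracket (B \<beta> u) (W ! i)])) = 0"
      using assms(8) W mem(2)[OF u, of \<beta>] unfolding ad_invariant_def by simp
    finally show ?thesis
      by (simp add: nabla_def covariant_derivative_def as)
  qed
  have H_swap: "H u i (permute_list (Transposition.transpose 0 (Suc i)) \<alpha>s) = - H u i \<alpha>s"
    if u: "u \<in> D" and i: "i < k" and len: "length \<alpha>s = Suc k" for u i \<alpha>s
  proof -
    obtain \<beta> as where as: "\<alpha>s = \<beta> # as" "length as = k"
      using len by (metis length_Suc_conv)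
    \<comment> \<open>Position \<open>Suc i\<close> of the full list is position \<open>i\<close> of
      \<open>as\<close>, since the index of differentiation occupies position 0.\<close>
    have perm: "permute_list (Transposition.transpose 0 (Suc i)) \<alpha>s = as ! i # as[i := \<beta>]"
    proof (rule nth_equalityI)
      fix j assume j: "j < length (permute_list (Transposition.transpose 0 (Suc i)) \<alpha>s)"
      then have "permute_list (Transposition.transpose 0 (Suc i)) \<alpha>s ! j = \<alpha>s ! Transposition.transpose 0 (Suc i) j"
        by (simp add: permute_list_def del: upt_Suc)
      also have "\<dots> = (as ! i # as[i := \<beta>]) ! j"
        using i j as by (cases j) (auto simp: Transposition.transpose_def)
      finally show "permute_list (Transposition.transpose 0 (Suc i)) \<alpha>s ! j = (as ! i # as[i := \<beta>]) ! j" .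
    qed (simp add: as)
    let ?W = "map (\<lambda>\<alpha>. ?S \<alpha> u) as @ replicate p (M u)"
    have W: "length ?W = k + p" "set ?W \<subseteq> \<gg>"
      using as Smem mem u by auto
    \<comment> \<open>The exchanged index sits in slot \<open>i\<close>, which is overwritten by
      \<open>C\<close>; hence the swap only interchanges the two indices of
      \<open>C\<close>.\<close>
    have "H u i (permute_list (Transposition.transpose 0 (Suc i)) \<alpha>s) = f (?W[i := C u \<beta> (as ! i)])"
      using i as unfolding perm by (simp add: H_def map_update list_update_append)
    also have "\<dots> = - f (?W[i := C u (as ! i) \<beta>])"
      unfolding C_anti[of u \<beta>] using i Cmem[OF u] by (intro multilinear_on_minus[OF mf W]) auto
    finally show ?thesis by (simp add: H_def as)
  qed
  have "symmetrization (nabla G F) (\<beta> # \<alpha>s) u = 0" if "u \<in> D" "length \<alpha>s = k" for u \<beta> \<alpha>s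
    by (rule symmetrization_eq_0[where H = "H u" and k = k])
      (use that nabla_F H_swap in auto)
  then show ?thesis unfolding killing_field_def F_def by blast
qed

end
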